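(* Let $(M,g)$ be an $n$-dimensional Riemannian manifold, $n\geq 3$, and let $(V,\lambda)$ define an almost Ricci soliton on $(M,g)$. Then $(V,2\lambda)$ defines an almost Riemann soliton on $(M,g)$ if and only if the conharmonic curvature tensor field $\mathcal{H}$ of $g$ satisfies $\mathcal{H}=\frac{n-3}{n-2}R$.
   Context: Conventions: for $(0,2)$-tensor fields, $(T_1\odot T_2)(X,Y,Z,W)=T_1(X,W)T_2(Y,Z)+T_1(Y,Z)T_2(X,W)-T_1(X,Z)T_2(Y,W)-T_1(Y,W)T_2(X,Z)$ (Kulkarni-Nomizu product). $R(X,Y)Z=\nabla_X\nabla_YZ-\nabla_Y\nabla_XZ-\nabla_{[X,Y]}Z$ with $\nabla$ the Levi-Civita connection, and $R$ also denotes the $(0,4)$ tensor $R(X,Y,Z,W)=g(R(X,Y)Z,W)$; $\operatorname{Ric}(Y,Z)$ is the trace of $X\mapsto R(X,Y)Z$, and $Q$ is the Ricci operator, $g(QX,Y)=\operatorname{Ric}(X,Y)$. $G:=\frac12 g\odot g$. For a non-vanishing (nowhere zero) smooth vector field $V$ and a smooth function $\lambda$ on $M$: $(V,\lambda)$ defines an almost Riemann soliton if $\frac12(\pounds_Vg)\odot g+R=\lambda G$, and an almost Ricci soliton if $\frac12\pounds_Vg+\operatorname{Ric}=\lambda g$, where $\pounds_V$ is the Lie derivative. The conharmonic curvature tensor is $$\mathcal{H}(X,Y)Z:=R(X,Y)Z+\frac{1}{n-2}\left[g(Z,X)QY-g(Y,Z)QX+\operatorname{Ric}(Z,X)Y-\operatorname{Ric}(Y,Z)X\right].$$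 *)

theory Defs
  imports "HOL-Analysis.Analysis" "HOL-Library.Function_Algebras"
begin

text \<open>
  Pointwise real vector space structure on functions.  It makes the library notions
  \<^term>\<open>span\<close>, \<^term>\<open>independent\<close> and \<^term>\<open>representation\<close> available for tangent
  vectors, which are real-valued functionals.
\<close>

instantiation "fun" :: (type, real_vector) real_vector
begin

definition "scaleR r f = (\<lambda>x. r *\<^sub>R f x)"

instance
  by standard (simp_all add: scaleR_fun_def plus_fun_def fun_eq_iff algebra_simps)

end


section \<open>Smooth manifolds\<close>

text \<open>Meaningful for open \<open>S\<close>: all iterated directional derivatives of order at most \<open>k\<close>
  exist as Frechet derivatives, and are continuous.\<close>

primrec Ck_on ::
  "nat \<Rightarrow> ('e::euclidean_space \<Rightarrow> 'f::real_normed_vector) \<Rightarrow> 'e set \<Rightarrow> bool" where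
  "Ck_on 0 f S \<longleftrightarrow> continuous_on S f"
| "Ck_on (Suc k) f S \<longleftrightarrow>
     (\<forall>x\<in>S. f differentiable (at x)) \<and>
     (\<forall>v. Ck_on k (\<lambda>x. frechet_derivative f (at x) v) S)"

definition smooth_on ::
  "('e::euclidean_space \<Rightarrow> 'f::real_normed_vector) \<Rightarrow> 'e set \<Rightarrow> bool" where
  "smooth_on f S \<longleftrightarrow> (\<forall>k. Ck_on k f S)"

text \<open>A chart is a pair of its domain and its coordinate map; only the values of the map on
  the domain matter.\<close>

type_synonym ('a, 'n) chart = "'a set \<times> ('a \<Rightarrow> real ^ 'n)"

definition is_chart :: "'a topology \<Rightarrow> ('a, 'n::finite) chart \<Rightarrow> bool" where
  "is_chart M = (\<lambda>(U, \<phi>). openin M U \<and> open (\<phi> ` U) \<and>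
     homeomorphic_map (subtopology M U) (top_of_set (\<phi> ` U)) \<phi>)"

locale smooth_manifold =
  fixes M :: "'a topology" and A :: "('a, 'n::finite) chart set"
  assumes Hausdorff: "Hausdorff_space M"
    and second_countable: "second_countable M"
    and charts: "\<And>c. c \<in> A \<Longrightarrow> is_chart M c"
    and cover: "(\<Union>(U, \<phi>)\<in>A. U) = topspace M"
    and compatible: "\<And>U \<phi> W \<psi>. (U, \<phi>) \<in> A \<Longrightarrow> (W, \<psi>) \<in> A \<Longrightarrow>
          smooth_on (\<psi> \<circ> inv_into U \<phi>) (\<phi> ` (U \<inter> W))"

text \<open>The values of a smooth function outside the carrier are unconstrained.\<close>

definition smooth_functions :: "('a, 'n::finite) chart set \<Rightarrow> ('a \<Rightarrow> real) set" where
  "smooth_functions A = {f. \<forall>(U, \<phi>)\<in>A. smooth_on (f \<circ> inv_into U \<phi>) (\<phi> ` U)}"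

text \<open>Tangent vectors at \<open>p\<close> are the derivations at \<open>p\<close> of the algebra of smooth functions.
  They are set to \<open>0\<close> on non-smooth arguments so that equality of functionals is equality of
  derivations.  No condition on the values of the arguments outside the carrier is needed:
  if \<open>f\<close> vanishes on the carrier and \<open>h\<close> is \<open>0\<close> on the carrier and \<open>1\<close> outside,
  then \<open>f = f h\<close>, so the Leibniz rule gives \<open>D f = 0\<close>.\<close>

type_synonym 'a tangent = "('a \<Rightarrow> real) \<Rightarrow> real"

definition tangent_space ::
  "('a, 'n::finite) chart set \<Rightarrow> 'a \<Rightarrow> 'a tangent set" where
  "tangent_space A p = {D.
     (\<forall>f\<in>smooth_functions A. \<forall>h\<in>smooth_functions A. D (\<lambda>q. f q + h q) = D f + D h) \<and>
     (\<forall>f\<in>smooth_functions A. \<forall>c. D (\<lambda>q. c * f q) = c * D f) \<and>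
     (\<forall>f\<in>smooth_functions A. \<forall>h\<in>smooth_functions A.
        D (\<lambda>q. f q * h q) = f p * D h + h p * D f) \<and>
     (\<forall>f. f \<notin> smooth_functions A \<longrightarrow> D f = 0)}"

text \<open>Smooth vector fields, extended by \<open>0\<close> outside the carrier.\<close>

type_synonym 'a vfield = "'a \<Rightarrow> 'a tangent"

definition vector_fields ::
  "'a topology \<Rightarrow> ('a, 'n::finite) chart set \<Rightarrow> 'a vfield set" where
  "vector_fields M A = {X.
     (\<forall>p\<in>topspace M. X p \<in> tangent_space A p) \<and>
     (\<forall>p. p \<notin> topspace M \<longrightarrow> X p = 0) \<and>
     (\<forall>f\<in>smooth_functions A. (\<lambda>p. X p f) \<in> smooth_functions A)}"

definition lie_bracket :: "'a vfield \<Rightarrow> 'a vfield \<Rightarrow> 'a vfield" where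
  "lie_bracket X Y = (\<lambda>p f. X p (\<lambda>q. Y q f) - Y p (\<lambda>q. X q f))"


section \<open>Riemannian metrics and the Levi-Civita connection\<close>

type_synonym 'a metric = "'a \<Rightarrow> 'a tangent \<Rightarrow> 'a tangent \<Rightarrow> real"

locale riemannian_manifold = smooth_manifold M A
  for M :: "'a topology" and A :: "('a, 'n::finite) chart set" +
  fixes g :: "'a metric"
  assumes metric_add: "\<And>p u v w. p \<in> topspace M \<Longrightarrow> u \<in> tangent_space A p \<Longrightarrow>
          v \<in> tangent_space A p \<Longrightarrow> w \<in> tangent_space A p \<Longrightarrow> g p (u + v) w = g p u w + g p v w"
    and metric_scale: "\<And>p c u w. p \<in> topspace M \<Longrightarrow> u \<in> tangent_space A p \<Longrightarrow>
          w \<in> tangent_space A p \<Longrightarrow> g p (c *\<^sub>R u) w = c * g p u w"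
    and metric_sym: "\<And>p u w. p \<in> topspace M \<Longrightarrow> u \<in> tangent_space A p \<Longrightarrow>
          w \<in> tangent_space A p \<Longrightarrow> g p u w = g p w u"
    and metric_pos: "\<And>p u. p \<in> topspace M \<Longrightarrow> u \<in> tangent_space A p \<Longrightarrow> u \<noteq> 0 \<Longrightarrow>
          g p u u > 0"
    and metric_smooth: "\<And>X Y. X \<in> vector_fields M A \<Longrightarrow> Y \<in> vector_fields M A \<Longrightarrow>
          (\<lambda>p. g p (X p) (Y p)) \<in> smooth_functions A"

text \<open>Covariant tensor fields are represented by their action on smooth vector fields.\<close>

type_synonym 'a tensor2 = "'a vfield \<Rightarrow> 'a vfield \<Rightarrow> 'a \<Rightarrow> real"
type_synonym 'a tensor4 = "'a vfield \<Rightarrow> 'a vfield \<Rightarrow> 'a vfield \<Rightarrow> 'a vfield \<Rightarrow> 'a \<Rightarrow> real"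

definition metric_tensor :: "'a metric \<Rightarrow> 'a tensor2" where
  "metric_tensor g X Y p = g p (X p) (Y p)"

type_synonym 'a connection = "'a vfield \<Rightarrow> 'a vfield \<Rightarrow> 'a vfield"

definition affine_connection ::
  "'a topology \<Rightarrow> ('a, 'n::finite) chart set \<Rightarrow> 'a connection \<Rightarrow> bool" where
  "affine_connection M A nabla \<longleftrightarrow>
     (\<forall>X\<in>vector_fields M A. \<forall>Y\<in>vector_fields M A. nabla X Y \<in> vector_fields M A) \<and>
     (\<forall>X\<in>vector_fields M A. \<forall>X'\<in>vector_fields M A. \<forall>Y\<in>vector_fields M A.
        nabla (X + X') Y = nabla X Y + nabla X' Y) \<and>
     (\<forall>X\<in>vector_fields M A. \<forall>Y\<in>vector_fields M A. \<forall>Y'\<in>vector_fields M A.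
        nabla X (Y + Y') = nabla X Y + nabla X Y') \<and>
     (\<forall>f\<in>smooth_functions A. \<forall>X\<in>vector_fields M A. \<forall>Y\<in>vector_fields M A.
        nabla (\<lambda>p. f p *\<^sub>R X p) Y = (\<lambda>p. f p *\<^sub>R nabla X Y p)) \<and>
     (\<forall>f\<in>smooth_functions A. \<forall>X\<in>vector_fields M A. \<forall>Y\<in>vector_fields M A.
        nabla X (\<lambda>p. f p *\<^sub>R Y p) = (\<lambda>p. X p f *\<^sub>R Y p + f p *\<^sub>R nabla X Y p))"

text \<open>By the fundamental theorem of Riemannian geometry exactly one operation on smooth vector
  fields has this property.\<close>

definition levi_civita ::
  "'a topology \<Rightarrow> ('a, 'n::finite) chart set \<Rightarrow> 'a metric \<Rightarrow> 'a connection \<Rightarrow> bool" where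
  "levi_civita M A g nabla \<longleftrightarrow> affine_connection M A nabla \<and>
     (\<forall>X\<in>vector_fields M A. \<forall>Y\<in>vector_fields M A.
        nabla X Y - nabla Y X = lie_bracket X Y) \<and>
     (\<forall>X\<in>vector_fields M A. \<forall>Y\<in>vector_fields M A. \<forall>Z\<in>vector_fields M A. \<forall>p\<in>topspace M.
        X p (metric_tensor g Y Z) =
          metric_tensor g (nabla X Y) Z p + metric_tensor g Y (nabla X Z) p)"


section \<open>Curvature\<close>

definition curvature :: "'a connection \<Rightarrow> 'a vfield \<Rightarrow> 'a vfield \<Rightarrow> 'a vfield \<Rightarrow> 'a vfield" where
  "curvature nabla X Y Z =
     nabla X (nabla Y Z) - nabla Y (nabla X Z) - nabla (lie_bracket X Y) Z"

definition curvature_tensor :: "'a metric \<Rightarrow> 'a connection \<Rightarrow> 'a tensor4" where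
  "curvature_tensor g nabla X Y Z W = metric_tensor g (curvature nabla X Y Z) W"

text \<open>Trace of an endomorphism of a finite-dimensional subspace, computed in an arbitrary basis.\<close>

definition trace_on :: "'v::real_vector set \<Rightarrow> ('v \<Rightarrow> 'v) \<Rightarrow> real" where
  "trace_on V F = (let B = (SOME B. independent B \<and> span B = V)
     in \<Sum>b\<in>B. representation B (F b) b)"

text \<open>Some smooth vector field with prescribed value \<open>x\<close> at \<open>p\<close>; as the curvature is tensorial,
  the choice does not influence the definition of the Ricci tensor.\<close>

definition extend_vector ::
  "'a topology \<Rightarrow> ('a, 'n::finite) chart set \<Rightarrow> 'a \<Rightarrow> 'a tangent \<Rightarrow> 'a vfield" where
  "extend_vector M A p x = (SOME X. X \<in> vector_fields M A \<and> X p = x)"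

definition ricci ::
  "'a topology \<Rightarrow> ('a, 'n::finite) chart set \<Rightarrow> 'a connection \<Rightarrow> 'a tensor2" where
  "ricci M A nabla Y Z p =
     trace_on (tangent_space A p) (\<lambda>x. curvature nabla (extend_vector M A p x) Y Z p)"

definition ricci_operator ::
  "'a topology \<Rightarrow> ('a, 'n::finite) chart set \<Rightarrow> 'a metric \<Rightarrow> 'a connection \<Rightarrow>
     ('a vfield \<Rightarrow> 'a vfield) \<Rightarrow> bool" where
  "ricci_operator M A g nabla Q \<longleftrightarrow>
     (\<forall>X\<in>vector_fields M A. Q X \<in> vector_fields M A) \<and>
     (\<forall>X\<in>vector_fields M A. \<forall>Y\<in>vector_fields M A. \<forall>p\<in>topspace M.
        metric_tensor g (Q X) Y p = ricci M A nabla X Y p)"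

text \<open>The type of the atlas fixes the dimension \<open>n = CARD('n)\<close> of the manifold.\<close>

definition conharmonic ::
  "'a topology \<Rightarrow> ('a, 'n::finite) chart set \<Rightarrow> 'a metric \<Rightarrow> 'a connection \<Rightarrow>
     ('a vfield \<Rightarrow> 'a vfield) \<Rightarrow> 'a vfield \<Rightarrow> 'a vfield \<Rightarrow> 'a vfield \<Rightarrow> 'a vfield" where
  "conharmonic M A g nabla Q X Y Z = (\<lambda>p. curvature nabla X Y Z p +
     (1 / (real CARD('n) - 2)) *\<^sub>R
       (metric_tensor g Z X p *\<^sub>R Q Y p - metric_tensor g Y Z p *\<^sub>R Q X p
        + ricci M A nabla Z X p *\<^sub>R Y p - ricci M A nabla Y Z p *\<^sub>R X p))"


section \<open>Solitons\<close>

definition Kulkarni_Nomizu :: "'a tensor2 \<Rightarrow> 'a tensor2 \<Rightarrow> 'a tensor4" where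
  "Kulkarni_Nomizu T1 T2 X Y Z W p =
     T1 X W p * T2 Y Z p + T1 Y Z p * T2 X W p - T1 X Z p * T2 Y W p - T1 Y W p * T2 X Z p"

definition G_tensor :: "'a metric \<Rightarrow> 'a tensor4" where
  "G_tensor g X Y Z W p = 1 / 2 * Kulkarni_Nomizu (metric_tensor g) (metric_tensor g) X Y Z W p"

definition lie_derivative_metric :: "'a metric \<Rightarrow> 'a vfield \<Rightarrow> 'a tensor2" where
  "lie_derivative_metric g V X Y p = V p (metric_tensor g X Y)
     - metric_tensor g (lie_bracket V X) Y p - metric_tensor g X (lie_bracket V Y) p"

definition soliton_data ::
  "'a topology \<Rightarrow> ('a, 'n::finite) chart set \<Rightarrow> 'a vfield \<Rightarrow> ('a \<Rightarrow> real) \<Rightarrow> bool" where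
  "soliton_data M A V lam \<longleftrightarrow> V \<in> vector_fields M A \<and> (\<forall>p\<in>topspace M. V p \<noteq> 0) \<and>
     lam \<in> smooth_functions A"

definition almost_Ricci_soliton ::
  "'a topology \<Rightarrow> ('a, 'n::finite) chart set \<Rightarrow> 'a metric \<Rightarrow> 'a connection \<Rightarrow>
     'a vfield \<Rightarrow> ('a \<Rightarrow> real) \<Rightarrow> bool" where
  "almost_Ricci_soliton M A g nabla V lam \<longleftrightarrow> soliton_data M A V lam \<and>
     (\<forall>X\<in>vector_fields M A. \<forall>Y\<in>vector_fields M A. \<forall>p\<in>topspace M.
        1 / 2 * lie_derivative_metric g V X Y p + ricci M A nabla X Y p =
          lam p * metric_tensor g X Y p)"

definition almost_Riemann_soliton ::
  "'a topology \<Rightarrow> ('a, 'n::finite) chart set \<Rightarrow> 'a metric \<Rightarrow> 'a connection \<Rightarrow>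
     'a vfield \<Rightarrow> ('a \<Rightarrow> real) \<Rightarrow> bool" where
  "almost_Riemann_soliton M A g nabla V lam \<longleftrightarrow> soliton_data M A V lam \<and>
     (\<forall>X\<in>vector_fields M A. \<forall>Y\<in>vector_fields M A.
      \<forall>Z\<in>vector_fields M A. \<forall>W\<in>vector_fields M A. \<forall>p\<in>topspace M.
        1 / 2 * Kulkarni_Nomizu (lie_derivative_metric g V) (metric_tensor g) X Y Z W p
          + curvature_tensor g nabla X Y Z W p = lam p * G_tensor g X Y Z W p)"

end

theory Submission
  imports Defs
begin

text \<open>
  Substituting the Ricci soliton equation \<open>\<pounds>\<^sub>V g / 2 = \<lambda> g - Ric\<close> into the Riemann soliton
  equation for \<open>2 \<lambda>\<close> cancels \<open>\<lambda>\<close> and leaves \<open>R = Ric \<odot> g\<close>.  On the other hand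
  \<open>g(H(X, Y)Z, W) = (R - (Ric \<odot> g) / (n - 2))(X, Y, Z, W)\<close>, so by nondegeneracy of \<open>g\<close> the
  condition \<open>H = ((n - 3) / (n - 2)) R\<close> is equivalent to the same equation.  The symmetry of
  \<open>Ric\<close> used here is inherited from that of \<open>\<pounds>\<^sub>V g\<close> through the Ricci soliton equation.
\<close>

section \<open>Linear structure of smooth functions, tangent spaces and vector fields\<close>

lemma scaleR_fun_apply: "(c *\<^sub>R f) x = c *\<^sub>R f x"
  by (simp add: scaleR_fun_def)

text \<open>Openness of \<open>S\<close> lets agreement on \<open>S\<close> pass to derivatives at
  points of \<open>S\<close>. The closure rules below depend on this: the derivative of a sum or a
  multiple is identified only at points of \<open>S\<close>.\<close>

lemma Ck_on_cong:
  assumes "open S" "\<And>x. x \<in> S \<Longrightarrow> f x = h x" "Ck_on k f S"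
  shows "Ck_on k h S"
  using assms(2,3)
proof (induction k arbitrary: f h)
  case 0
  then show ?case by (simp cong: continuous_on_cong)
next
  case (Suc k)
  have "h differentiable (at x)" if "x \<in> S" for x
  proof -
    have "f differentiable (at x)" using Suc.prems(2) that by simp
    then obtain f' where "(f has_derivative f') (at x)" unfolding differentiable_def by blast
    then have "(h has_derivative f') (at x)"
      using has_derivative_transform_within_open assms(1) that Suc.prems(1) by blast
    then show ?thesis by (auto simp: differentiable_def)
  qed
  moreover have "Ck_on k (\<lambda>x. frechet_derivative h (at x) v) S" for v
  proof (rule Suc.IH)
    show "Ck_on k (\<lambda>x. frechet_derivative f (at x) v) S"
      using Suc.prems by simp
    fix x assume "x \<in> S"
    moreover have "f differentiable (at x)" using Suc.prems(2) \<open>x \<in> S\<close> by simp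
    ultimately have "frechet_derivative f (at x) = frechet_derivative h (at x)"
      using assms(1) Suc.prems(1) by (intro frechet_derivative_transform_within_open)
    then show "frechet_derivative f (at x) v = frechet_derivative h (at x) v" by simp
  qed
  ultimately show ?case by simp
qed

lemma Ck_on_add:
  assumes "open S" "Ck_on k f S" "Ck_on k h S"
  shows "Ck_on k (\<lambda>x. f x + h x) S"
  using assms(2,3)
proof (induction k arbitrary: f h)
  case 0
  then show ?case by (simp add: continuous_on_add)
next
  case (Suc k)
  have "Ck_on k (\<lambda>x. frechet_derivative (\<lambda>y. f y + h y) (at x) v) S" for v
  proof (rule Ck_on_cong[OF assms(1)])
    show "Ck_on k (\<lambda>x. frechet_derivative f (at x) v + frechet_derivative h (at x) v) S"
      using Suc by simp
    show "frechet_derivative f (at x) v + frechet_derivative h (at x) v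
        = frechet_derivative (\<lambda>y. f y + h y) (at x) v" if "x \<in> S" for x
    proof -
      have "((\<lambda>y. f y + h y) has_derivative
          (\<lambda>v. frechet_derivative f (at x) v + frechet_derivative h (at x) v)) (at x)"
        using Suc.prems that by (intro has_derivative_add) (simp_all flip: frechet_derivative_works)
      from frechet_derivative_at[OF this] show ?thesis by (rule fun_cong)
    qed
  qed
  then show ?case using Suc.prems by (simp add: differentiable_add)
qed

lemma Ck_on_scaleR:
  assumes "open S" "Ck_on k f S"
  shows "Ck_on k (\<lambda>x. c *\<^sub>R f x) S"
  using assms(2)
proof (induction k arbitrary: f)
  case 0
  then show ?case by (simp add: continuous_on_scaleR)
next
  case (Suc k)
  have "Ck_on k (\<lambda>x. frechet_derivative (\<lambda>y. c *\<^sub>R f y) (at x) v) S" for v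
  proof (rule Ck_on_cong[OF assms(1)])
    show "Ck_on k (\<lambda>x. c *\<^sub>R frechet_derivative f (at x) v) S"
      using Suc by simp
    show "c *\<^sub>R frechet_derivative f (at x) v
        = frechet_derivative (\<lambda>y. c *\<^sub>R f y) (at x) v" if "x \<in> S" for x
    proof -
      have "((\<lambda>y. c *\<^sub>R f y) has_derivative (\<lambda>v. c *\<^sub>R frechet_derivative f (at x) v)) (at x)"
        using Suc.prems that
        by (intro has_derivative_scaleR_right) (simp flip: frechet_derivative_works)
      from frechet_derivative_at[OF this] show ?thesis by (rule fun_cong)
    qed
  qed
  then show ?case using Suc.prems by (simp add: differentiable_scaleR)
qed

lemma Ck_on_zero: "Ck_on k (\<lambda>x. 0) S"
  by (induction k) simp_all

lemma subspace_tangent_space: "subspace (tangent_space A p)"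
  unfolding subspace_def tangent_space_def
  by (auto simp: scaleR_fun_def algebra_simps)

context smooth_manifold
begin

lemma subspace_smooth_functions: "subspace (smooth_functions A)"
proof (rule subspaceI)
  have op: "open (\<phi> ` U)" if "(U, \<phi>) \<in> A" for U \<phi>
    using charts[OF that] by (simp add: is_chart_def)
  show "0 \<in> smooth_functions A"
    by (simp add: smooth_functions_def smooth_on_def o_def Ck_on_zero)
  show "f + h \<in> smooth_functions A" if "f \<in> smooth_functions A" "h \<in> smooth_functions A" for f h
    using that by (auto simp: smooth_functions_def smooth_on_def o_def intro!: Ck_on_add op)
  show "c *\<^sub>R f \<in> smooth_functions A" if "f \<in> smooth_functions A" for c f
    using that Ck_on_scaleR[OF op]
    by (fastforce simp: smooth_functions_def smooth_on_def o_def scaleR_fun_def)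
qed

text \<open>Closure under constant coefficients is the form used later, where scalar functions are
  frozen at a single point.\<close>

lemma subspace_vector_fields: "subspace (vector_fields M A)"
proof (rule subspaceI)
  note sm = subspace_smooth_functions and ts = subspace_tangent_space[of A]
  show "0 \<in> vector_fields M A"
    using subspace_0[OF sm] subspace_0[OF ts]
    by (auto simp: vector_fields_def zero_fun_def)
  show "X + Y \<in> vector_fields M A" if "X \<in> vector_fields M A" "Y \<in> vector_fields M A" for X Y
    using that subspace_add[OF sm] subspace_add[OF ts]
    by (auto simp: vector_fields_def plus_fun_def)
  show "c *\<^sub>R X \<in> vector_fields M A" if "X \<in> vector_fields M A" for c X
  proof -
    have "(\<lambda>p. (c *\<^sub>R X) p f) \<in> smooth_functions A" if "f \<in> smooth_functions A" for f
      using subspace_scale[OF sm, of "\<lambda>p. X p f" c] that \<open>X \<in> vector_fields M A\<close>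
      by (simp add: vector_fields_def scaleR_fun_def)
    then show ?thesis
      using that subspace_scale[OF ts] by (simp add: vector_fields_def scaleR_fun_apply)
  qed
qed

lemma vector_field_tangent:
  "X \<in> vector_fields M A \<Longrightarrow> p \<in> topspace M \<Longrightarrow> X p \<in> tangent_space A p"
  by (simp add: vector_fields_def)

end

section \<open>Metric algebra, curvature fields and symmetry of the Ricci tensor\<close>

context riemannian_manifold
begin

lemma metric_tensor_add_left:
  assumes "X \<in> vector_fields M A" "Y \<in> vector_fields M A" "Z \<in> vector_fields M A" "p \<in> topspace M"
  shows "metric_tensor g (X + Y) Z p = metric_tensor g X Z p + metric_tensor g Y Z p"
  using assms by (simp add: metric_tensor_def metric_add vector_field_tangent)

lemma metric_tensor_scale_left:
  assumes "X \<in> vector_fields M A" "Z \<in> vector_fields M A" "p \<in> topspace M"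
  shows "metric_tensor g (c *\<^sub>R X) Z p = c * metric_tensor g X Z p"
  using assms by (simp add: metric_tensor_def metric_scale vector_field_tangent scaleR_fun_apply)

lemma metric_tensor_diff_left:
  assumes "X \<in> vector_fields M A" "Y \<in> vector_fields M A" "Z \<in> vector_fields M A" "p \<in> topspace M"
  shows "metric_tensor g (X - Y) Z p = metric_tensor g X Z p - metric_tensor g Y Z p"
  using metric_tensor_add_left[of "X - Y" Y Z p] assms
  by (simp add: subspace_diff[OF subspace_vector_fields])

text \<open>Off the carrier both sides are \<open>g p 0 0\<close>, so the functions agree everywhere.\<close>

lemma metric_tensor_commute:
  assumes "X \<in> vector_fields M A" "Y \<in> vector_fields M A"
  shows "metric_tensor g X Y = metric_tensor g Y X"
proof
  fix p
  show "metric_tensor g X Y p = metric_tensor g Y X p"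
    using assms metric_sym by (cases "p \<in> topspace M") (auto simp: metric_tensor_def vector_fields_def)
qed

text \<open>For the converse, the global field \<open>X\<close> serves as its own test field, which
  reduces the claim to positive definiteness at \<open>p\<close>.\<close>

lemma metric_tensor_nondegenerate:
  assumes "X \<in> vector_fields M A" "p \<in> topspace M"
  shows "X p = 0 \<longleftrightarrow> (\<forall>W\<in>vector_fields M A. metric_tensor g X W p = 0)"
proof
  assume "X p = 0"
  then show "\<forall>W\<in>vector_fields M A. metric_tensor g X W p = 0"
    \<comment> \<open>Homogeneity with the scalar \<open>0\<close> evaluates the metric at the zero
      vector.\<close>
    using metric_tensor_scale_left[of X _ p 0] assms
    by (simp add: metric_tensor_def scaleR_fun_apply)
next
  assume "\<forall>W\<in>vector_fields M A. metric_tensor g X W p = 0"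
  then show "X p = 0"
    using metric_pos[of p "X p"] assms vector_field_tangent by (force simp: metric_tensor_def)
qed

text \<open>Torsion-freeness writes the bracket as a difference of covariant derivatives, which are
  smooth fields by the definition of a connection. This replaces a direct check of the Leibniz rule
  and of smoothness.\<close>

lemma lie_bracket_vector_field:
  assumes "levi_civita M A g nabla" "X \<in> vector_fields M A" "Y \<in> vector_fields M A"
  shows "lie_bracket X Y \<in> vector_fields M A"
proof -
  have "lie_bracket X Y = nabla X Y - nabla Y X"
    using assms by (simp add: levi_civita_def)
  moreover have "nabla X Y \<in> vector_fields M A" "nabla Y X \<in> vector_fields M A"
    using assms by (auto simp: levi_civita_def affine_connection_def)
  ultimately show ?thesis
    by (simp add: subspace_diff[OF subspace_vector_fields])
qed

lemma curvature_vector_field: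
  assumes "levi_civita M A g nabla"
    and "X \<in> vector_fields M A" "Y \<in> vector_fields M A" "Z \<in> vector_fields M A"
  shows "curvature nabla X Y Z \<in> vector_fields M A"
proof -
  have "nabla X Y \<in> vector_fields M A"
    if "X \<in> vector_fields M A" "Y \<in> vector_fields M A" for X Y
    using assms(1) that by (auto simp: levi_civita_def affine_connection_def)
  then show ?thesis
    using assms lie_bracket_vector_field
    by (simp add: curvature_def subspace_diff[OF subspace_vector_fields])
qed

lemma lie_derivative_metric_commute:
  assumes "levi_civita M A g nabla"
    and "V \<in> vector_fields M A" "X \<in> vector_fields M A" "Y \<in> vector_fields M A"
  shows "lie_derivative_metric g V X Y = lie_derivative_metric g V Y X"
proof
  fix p
  have "lie_bracket V X \<in> vector_fields M A" "lie_bracket V Y \<in> vector_fields M A"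
    using assms lie_bracket_vector_field by blast+
  \<comment> \<open>The two bracket terms trade places. The first term differentiates the function
    \<open>metric_tensor g X Y\<close>, so symmetry of the metric is applied as an equality of
    functions.\<close>
  then show "lie_derivative_metric g V X Y p = lie_derivative_metric g V Y X p"
    using assms metric_tensor_commute by (simp add: lie_derivative_metric_def)
qed

text \<open>Comparing the soliton equation at \<open>(X, Y)\<close> and at \<open>(Y, X)\<close>
  keeps the trace inside \<open>ricci\<close> folded.\<close>

lemma almost_Ricci_soliton_ricci_commute:
  assumes "levi_civita M A g nabla" "almost_Ricci_soliton M A g nabla V lam"
    and "X \<in> vector_fields M A" "Y \<in> vector_fields M A" "p \<in> topspace M"
  shows "ricci M A nabla X Y p = ricci M A nabla Y X p"
proof -
  have V: "V \<in> vector_fields M A"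
    and eq: "1 / 2 * lie_derivative_metric g V X Y p + ricci M A nabla X Y p
        = lam p * metric_tensor g X Y p"
      "1 / 2 * lie_derivative_metric g V Y X p + ricci M A nabla Y X p
        = lam p * metric_tensor g Y X p"
    using assms by (auto simp: almost_Ricci_soliton_def soliton_data_def)
  show ?thesis
    using eq lie_derivative_metric_commute[OF assms(1) V assms(3,4)]
      metric_tensor_commute[OF assms(3,4)] by simp
qed

text \<open>With \<open>k = n - 2\<close> and \<open>S\<close> the bracket in the definition of
  \<open>conharmonic\<close>, \<open>H = R + S / k = ((k - 1) / k) R + (R + S) / k\<close>.
  Proportionality thus says that \<open>R + S\<close> vanishes at \<open>p\<close>, and pairing with
  \<open>W\<close> turns \<open>S\<close> into minus the Kulkarni-Nomizu product.\<close>

lemma conharmonic_proportional_iff: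
  assumes "CARD('n) \<ge> 3" "levi_civita M A g nabla" "ricci_operator M A g nabla Q"
    and ricci_sym: "\<And>X Y. X \<in> vector_fields M A \<Longrightarrow> Y \<in> vector_fields M A \<Longrightarrow>
          ricci M A nabla X Y p = ricci M A nabla Y X p"
    and X: "X \<in> vector_fields M A" and Y: "Y \<in> vector_fields M A" and Z: "Z \<in> vector_fields M A"
    and p: "p \<in> topspace M"
  shows "conharmonic M A g nabla Q X Y Z p =
      ((real CARD('n) - 3) / (real CARD('n) - 2)) *\<^sub>R curvature nabla X Y Z p \<longleftrightarrow>
    (\<forall>W\<in>vector_fields M A. curvature_tensor g nabla X Y Z W p =
      Kulkarni_Nomizu (ricci M A nabla) (metric_tensor g) X Y Z W p)"
proof -
  note sub = subspace_vector_fields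
  define k where "k = real CARD('n) - 2"
  have k: "k > 0" "real CARD('n) - 3 = k - 1" using assms(1) by (auto simp: k_def)
  have Q: "Q X \<in> vector_fields M A" if "X \<in> vector_fields M A" for X
    using assms(3) that by (simp add: ricci_operator_def)
  have gQ: "metric_tensor g (Q X) Y p = ricci M A nabla X Y p"
    if "X \<in> vector_fields M A" "Y \<in> vector_fields M A" for X Y
    using assms(3) that p by (simp add: ricci_operator_def)
  \<comment> \<open>The coefficients are frozen at \<open>p\<close>, which keeps \<open>D\<close> a constant-coefficient
    combination of vector fields.\<close>
  define S where "S = metric_tensor g Z X p *\<^sub>R Q Y - metric_tensor g Y Z p *\<^sub>R Q X
      + ricci M A nabla Z X p *\<^sub>R Y - ricci M A nabla Y Z p *\<^sub>R X"
  define D where "D = curvature nabla X Y Z + S"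
  have R: "curvature nabla X Y Z \<in> vector_fields M A"
    using assms(2) X Y Z by (rule curvature_vector_field)
  have S: "S \<in> vector_fields M A"
    unfolding S_def using X Y Z Q
    by (intro subspace_add[OF sub] subspace_diff[OF sub] subspace_scale[OF sub])
  have D: "D \<in> vector_fields M A"
    unfolding D_def using R S by (rule subspace_add[OF sub])
  have "conharmonic M A g nabla Q X Y Z p
      = curvature nabla X Y Z p + (1 / k) *\<^sub>R S p"
    by (simp add: conharmonic_def S_def k_def scaleR_fun_apply)
  also have "\<dots> = ((k - 1) / k) *\<^sub>R curvature nabla X Y Z p + (1 / k) *\<^sub>R D p"
  proof -
    have "(k - 1) / k + 1 / k = 1" using k by (simp add: field_simps)
    then have "curvature nabla X Y Z p
        = ((k - 1) / k) *\<^sub>R curvature nabla X Y Z p + (1 / k) *\<^sub>R curvature nabla X Y Z p"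
      by (simp flip: scaleR_left_distrib)
    then show ?thesis
      by (simp add: D_def scaleR_right_distrib)
  qed
  finally have "conharmonic M A g nabla Q X Y Z p =
      ((k - 1) / k) *\<^sub>R curvature nabla X Y Z p \<longleftrightarrow> D p = 0"
    using k by simp
  also have "\<dots> \<longleftrightarrow> (\<forall>W\<in>vector_fields M A. metric_tensor g D W p = 0)"
    using metric_tensor_nondegenerate[OF D p] .
  also have "\<dots> \<longleftrightarrow> (\<forall>W\<in>vector_fields M A. curvature_tensor g nabla X Y Z W p =
      Kulkarni_Nomizu (ricci M A nabla) (metric_tensor g) X Y Z W p)"
  proof (rule ball_cong[OF refl])
    fix W assume W: "W \<in> vector_fields M A"
    have "metric_tensor g S W p
        = metric_tensor g Z X p * ricci M A nabla Y W p - metric_tensor g Y Z p * ricci M A nabla X W p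
          + ricci M A nabla Z X p * metric_tensor g Y W p - ricci M A nabla Y Z p * metric_tensor g X W p"
      unfolding S_def using X Y Z W Q p
      by (simp add: metric_tensor_add_left metric_tensor_diff_left metric_tensor_scale_left gQ
          subspace_add[OF sub] subspace_diff[OF sub] subspace_scale[OF sub])
    also have "\<dots> = - Kulkarni_Nomizu (ricci M A nabla) (metric_tensor g) X Y Z W p"
      \<comment> \<open>\<open>S\<close> takes its arguments in the order \<open>Z\<close>,
        \<open>X\<close>, the Kulkarni-Nomizu product in the order \<open>X\<close>,
        \<open>Z\<close>; here the symmetry of Ric enters.\<close>
      using ricci_sym[OF Z X] metric_tensor_commute[OF Z X]
      by (simp add: Kulkarni_Nomizu_def algebra_simps)
    finally show "metric_tensor g D W p = 0 \<longleftrightarrow> curvature_tensor g nabla X Y Z W p =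
        Kulkarni_Nomizu (ricci M A nabla) (metric_tensor g) X Y Z W p"
      using metric_tensor_add_left[OF R S W p] by (simp add: D_def curvature_tensor_def)
  qed
  finally show ?thesis unfolding k(2) k_def[symmetric] .
qed

end

text \<open>Inserting the Lie derivative \<open>2 (lam g - Ric)\<close> into the product with
  \<open>g\<close> yields \<open>lam\<close> times the product of \<open>g\<close> with itself,
  which is \<open>2 * lam\<close> times \<open>G_tensor\<close>. This explains the doubled
  function.\<close>

lemma almost_Ricci_soliton_Riemann_eq_iff:
  assumes "almost_Ricci_soliton M A g nabla V lam"
    and "X \<in> vector_fields M A" "Y \<in> vector_fields M A"
    and "Z \<in> vector_fields M A" "W \<in> vector_fields M A" "p \<in> topspace M"
  shows "1 / 2 * Kulkarni_Nomizu (lie_derivative_metric g V) (metric_tensor g) X Y Z W p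
      + curvature_tensor g nabla X Y Z W p = 2 * lam p * G_tensor g X Y Z W p \<longleftrightarrow>
    curvature_tensor g nabla X Y Z W p =
      Kulkarni_Nomizu (ricci M A nabla) (metric_tensor g) X Y Z W p"
proof -
  have L: "lie_derivative_metric g V X Y p
      = 2 * (lam p * metric_tensor g X Y p - ricci M A nabla X Y p)"
    if "X \<in> vector_fields M A" "Y \<in> vector_fields M A" for X Y
  proof -
    have "1 / 2 * lie_derivative_metric g V X Y p + ricci M A nabla X Y p
        = lam p * metric_tensor g X Y p"
      using assms(1,6) that by (simp add: almost_Ricci_soliton_def)
    then show ?thesis by simp
  qed
  have KN: "1 / 2 * Kulkarni_Nomizu (lie_derivative_metric g V) (metric_tensor g) X Y Z W p
      = 2 * lam p * G_tensor g X Y Z W p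
        - Kulkarni_Nomizu (ricci M A nabla) (metric_tensor g) X Y Z W p"
    using assms(2-5) by (simp add: Kulkarni_Nomizu_def G_tensor_def L) (simp add: algebra_simps)
  show ?thesis unfolding KN by auto
qed

theorem proposition2p16:
  fixes M :: "'a topology" and A :: "('a, 'n::finite) chart set" and g :: "'a metric"
    and nabla :: "'a connection" and Q :: "'a vfield \<Rightarrow> 'a vfield"
    and V :: "'a vfield" and lam :: "'a \<Rightarrow> real"
  assumes "riemannian_manifold M A g"
    and "CARD('n) \<ge> 3"
    and "levi_civita M A g nabla"
    and "ricci_operator M A g nabla Q"
    and "almost_Ricci_soliton M A g nabla V lam"
  shows "almost_Riemann_soliton M A g nabla V (\<lambda>p. 2 * lam p) \<longleftrightarrow>
    (\<forall>X\<in>vector_fields M A. \<forall>Y\<in>vector_fields M A. \<forall>Z\<in>vector_fields M A. \<forall>p\<in>topspace M.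
       conharmonic M A g nabla Q X Y Z p =
         ((real CARD('n) - 3) / (real CARD('n) - 2)) *\<^sub>R curvature nabla X Y Z p)"
proof -
  interpret riemannian_manifold M A g by fact
  have key: "conharmonic M A g nabla Q X Y Z p =
      ((real CARD('n) - 3) / (real CARD('n) - 2)) *\<^sub>R curvature nabla X Y Z p \<longleftrightarrow>
    (\<forall>W\<in>vector_fields M A. curvature_tensor g nabla X Y Z W p =
      Kulkarni_Nomizu (ricci M A nabla) (metric_tensor g) X Y Z W p)"
    if "X \<in> vector_fields M A" "Y \<in> vector_fields M A" "Z \<in> vector_fields M A" "p \<in> topspace M"
    for X Y Z p
    using that assms almost_Ricci_soliton_ricci_commute[OF assms(3,5)]
    by (intro conharmonic_proportional_iff)
  \<comment> \<open>The conditions on \<open>V\<close> carry over from the Ricci soliton; smoothness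
    of the doubled function is what remains.\<close>
  have "soliton_data M A V (\<lambda>p. 2 * lam p)"
    using assms(5) subspace_scale[OF subspace_smooth_functions, of lam 2]
    by (simp add: almost_Ricci_soliton_def soliton_data_def scaleR_fun_def)
  then have "almost_Riemann_soliton M A g nabla V (\<lambda>p. 2 * lam p) \<longleftrightarrow>
    (\<forall>X\<in>vector_fields M A. \<forall>Y\<in>vector_fields M A. \<forall>Z\<in>vector_fields M A.
      \<forall>W\<in>vector_fields M A. \<forall>p\<in>topspace M. curvature_tensor g nabla X Y Z W p =
        Kulkarni_Nomizu (ricci M A nabla) (metric_tensor g) X Y Z W p)"
    using almost_Ricci_soliton_Riemann_eq_iff[OF assms(5)]
    by (simp add: almost_Riemann_soliton_def)
  also have "\<dots> \<longleftrightarrow>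
    (\<forall>X\<in>vector_fields M A. \<forall>Y\<in>vector_fields M A. \<forall>Z\<in>vector_fields M A. \<forall>p\<in>topspace M.
       conharmonic M A g nabla Q X Y Z p =
         ((real CARD('n) - 3) / (real CARD('n) - 2)) *\<^sub>R curvature nabla X Y Z p)"
    \<comment> \<open>\<open>key\<close> fixes the point before quantifying over \<open>W\<close>,
      so the quantifiers over \<open>W\<close> and \<open>p\<close> are exchanged here.\<close>
    by (auto simp: key)
  finally show ?thesis .
qed

end
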